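(* The category $\mathbf{ConvexRel}$ is a dagger compact closed category, where: (i) the symmetric monoidal structure has monoidal product $(A,\alpha)\otimes(B,\beta)$ (the convex algebra on $A\times B$ with mixing $\sum_i p_i|(a_i,b_i)\rangle\mapsto(\sum_i p_i a_i,\sum_i p_i b_i)$), acting on morphisms by the product of relations, and monoidal unit $I$ (the one-point set $\{*\}$ with its unique convex algebra structure); (ii) the dagger of a morphism $R:(A,\alpha)\to(B,\beta)$ is its relational converse $R^{\dagger}=\{(b,a)\mid (a,b)\in R\}:(B,\beta)\to(A,\alpha)$; (iii) for each object $(A,\alpha)$, the cap $\eta_{(A,\alpha)}:I\to(A,\alpha)\otimes(A,\alpha)$ is the relation $\{( *,(a,a))\mid a\in A\}$ and the cup $\epsilon_{(A,\alpha)}:(A,\alpha)\otimes(A,\alpha)\to I$ is its converse $\{((a,a),* )\mid a\in A\}$. Moreover, every object $(A,\alpha)$ carries a commutative special dagger Frobenius structure whose comultiplication (copy) is the relation $\{(a,(a,a))\mid a\in A\}:(A,\alpha)\to(A,\alpha)\otimes(A,\alpha)$ and whose counit (delete) is the relation $\{(a,* )\mid a\in A\}:(A,\alpha)\to I$, with multiplication and unit given by the converses (daggers) of these.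
   Context: For a set $X$, $D(X)$ denotes the set of finite formal convex sums $\sum_i p_i|x_i\rangle$ of elements $x_i\in X$, with $p_i\in\mathbb{R}^{\ge 0}$ and $\sum_i p_i=1$ (equivalently, finitely supported probability distributions on $X$). A convex algebra is a pair $(A,\alpha)$ with $A$ a set and $\alpha:D(A)\to A$ a function satisfying $\alpha(|a\rangle)=a$ for all $a\in A$ and $\alpha(\sum_{i,j}p_iq_{i,j}|a_{i,j}\rangle)=\alpha(\sum_i p_i|\alpha(\sum_j q_{i,j}|a_{i,j}\rangle)\rangle)$ for all finite families (where $\sum_i p_i=1$ and $\sum_j q_{i,j}=1$ for each $i$). One abbreviates $\sum_i p_i a_i:=\alpha(\sum_i p_i|a_i\rangle)$. A convex relation $(A,\alpha)\to(B,\beta)$ is a binary relation $R\subseteq A\times B$ such that whenever $R(a_i,b_i)$ holds for all $i$ in a finite family and $\sum_i p_i|\cdot\rangle$ is any formal convex combination, then $R(\sum_i p_i a_i,\sum_i p_i b_i)$ holds. The category $\mathbf{ConvexRel}$ has convex algebras as objects and convex relations as morphisms, with composition and identities as for ordinary binary relations. A Frobenius structure on an object is a comonoid (comultiplication, counit) and monoid (multiplication, unit) satisfying the Frobenius law; it is dagger if the monoid is the dagger of the comonoid, special if multiplication after comultiplication is the identity, and commutative if the monoid and comonoid are (co)commutative with respect to the symmetry. *)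

theory Defs
  imports "HOL-Probability.Probability_Mass_Function"
begin

definition FD :: "'a set \<Rightarrow> 'a pmf set" where
  "FD X = {p. finite (set_pmf p) \<and> set_pmf p \<subseteq> X}"

text \<open>Convex algebra (A, alpha) with alpha : D(A) -> A (values outside D(A) irrelevant).
  The second law, for finite families p_i, q_{i,j}, is equivalently stated with a finitely
  supported distribution Phi over D(A): alpha (join Phi) = alpha (map alpha Phi).\<close>
definition convex_algebra :: "'a set \<Rightarrow> ('a pmf \<Rightarrow> 'a) \<Rightarrow> bool" where
  "convex_algebra A \<alpha> \<longleftrightarrow>
     (\<forall>p\<in>FD A. \<alpha> p \<in> A) \<and>
     (\<forall>a\<in>A. \<alpha> (return_pmf a) = a) \<and>
     (\<forall>\<Phi>\<in>FD (FD A). \<alpha> (join_pmf \<Phi>) = \<alpha> (map_pmf \<alpha> \<Phi>))"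

text \<open>Convex relation (A,alpha) -> (B,beta): a relation R \<subseteq> A \<times> B closed under
  convex combinations (a finite family of related pairs with weights = a finitely supported
  distribution on R).\<close>
definition convex_rel :: "'a set \<Rightarrow> ('a pmf \<Rightarrow> 'a) \<Rightarrow> 'b set \<Rightarrow> ('b pmf \<Rightarrow> 'b) \<Rightarrow> ('a \<times> 'b) set \<Rightarrow> bool" where
  "convex_rel A \<alpha> B \<beta> R \<longleftrightarrow>
     R \<subseteq> A \<times> B \<and> (\<forall>r\<in>FD R. (\<alpha> (map_pmf fst r), \<beta> (map_pmf snd r)) \<in> R)"

definition tensor_alg :: "('a pmf \<Rightarrow> 'a) \<Rightarrow> ('b pmf \<Rightarrow> 'b) \<Rightarrow> ('a \<times> 'b) pmf \<Rightarrow> 'a \<times> 'b" where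
  "tensor_alg \<alpha> \<beta> r = (\<alpha> (map_pmf fst r), \<beta> (map_pmf snd r))"

definition unit_alg :: "unit pmf \<Rightarrow> unit" where
  "unit_alg p = ()"

abbreviation Iset :: "unit set" where
  "Iset \<equiv> UNIV"

definition rtensor :: "('a \<times> 'b) set \<Rightarrow> ('c \<times> 'd) set \<Rightarrow> (('a \<times> 'c) \<times> ('b \<times> 'd)) set" where
  "rtensor R S = {((a, c), (b, d)) | a b c d. (a, b) \<in> R \<and> (c, d) \<in> S}"

definition assoc_rel :: "'a set \<Rightarrow> 'b set \<Rightarrow> 'c set \<Rightarrow> ((('a \<times> 'b) \<times> 'c) \<times> ('a \<times> ('b \<times> 'c))) set" where
  "assoc_rel A B C = {(((a, b), c), (a, (b, c))) | a b c. a \<in> A \<and> b \<in> B \<and> c \<in> C}"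

definition lunit_rel :: "'a set \<Rightarrow> ((unit \<times> 'a) \<times> 'a) set" where
  "lunit_rel A = {(((), a), a) | a. a \<in> A}"

definition runit_rel :: "'a set \<Rightarrow> (('a \<times> unit) \<times> 'a) set" where
  "runit_rel A = {((a, ()), a) | a. a \<in> A}"

definition swap_rel :: "'a set \<Rightarrow> 'b set \<Rightarrow> (('a \<times> 'b) \<times> ('b \<times> 'a)) set" where
  "swap_rel A B = {((a, b), (b, a)) | a b. a \<in> A \<and> b \<in> B}"

definition cap_rel :: "'a set \<Rightarrow> (unit \<times> ('a \<times> 'a)) set" where
  "cap_rel A = {((), (a, a)) | a. a \<in> A}"

definition cup_rel :: "'a set \<Rightarrow> (('a \<times> 'a) \<times> unit) set" where
  "cup_rel A = {((a, a), ()) | a. a \<in> A}"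

definition copy_rel :: "'a set \<Rightarrow> ('a \<times> ('a \<times> 'a)) set" where
  "copy_rel A = {(a, (a, a)) | a. a \<in> A}"

definition delete_rel :: "'a set \<Rightarrow> ('a \<times> unit) set" where
  "delete_rel A = {(a, ()) | a. a \<in> A}"

end

theory Submission
  imports Defs
begin

text \<open>The graph of a homomorphism of convex algebras is a convex relation, and convex relations are
  closed under composition, converse and product. The structural isomorphisms, copying and deleting
  are graphs of homomorphisms, and the cup is the converse of copying followed by deleting, so all
  structure maps are convex. The equations between them already hold in the category of
  sets and relations.\<close>

section \<open>Finitely supported distributions and products of convex algebras\<close>

lemma FD_map_pmf: "p \<in> FD X \<Longrightarrow> (\<And>x. x \<in> X \<Longrightarrow> f x \<in> Y) \<Longrightarrow> map_pmf f p \<in> FD Y"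
  by (auto simp: FD_def)

lemma FD_memD: "p \<in> FD X \<Longrightarrow> x \<in> set_pmf p \<Longrightarrow> x \<in> X"
  by (auto simp: FD_def)

text \<open>Naturality of the multiplication of the distribution monad; it moves the projections of
  a product inside \<open>join_pmf\<close>.\<close>

lemma map_pmf_join: "map_pmf f (join_pmf \<Phi>) = join_pmf (map_pmf (map_pmf f) \<Phi>)"
  by (simp add: join_eq_bind_pmf map_bind_pmf bind_map_pmf)

lemma convex_algebra_closed: "convex_algebra A \<alpha> \<Longrightarrow> p \<in> FD A \<Longrightarrow> \<alpha> p \<in> A"
  by (simp add: convex_algebra_def)

lemma convex_algebra_unit: "convex_algebra Iset unit_alg"
  by (simp add: convex_algebra_def)

text \<open>Both laws hold coordinatewise, because taking a marginal commutes with point masses and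
  with \<open>join_pmf\<close>.\<close>

lemma convex_algebra_tensor:
  assumes A: "convex_algebra A \<alpha>" and B: "convex_algebra B \<beta>"
  shows "convex_algebra (A \<times> B) (tensor_alg \<alpha> \<beta>)"
  unfolding convex_algebra_def
proof (intro conjI ballI)
  fix p assume p: "p \<in> FD (A \<times> B)"
  have "map_pmf fst p \<in> FD A" "map_pmf snd p \<in> FD B"
    by (auto intro: FD_map_pmf[OF p])
  then show "tensor_alg \<alpha> \<beta> p \<in> A \<times> B"
    using A B by (simp add: tensor_alg_def convex_algebra_closed)
next
  fix x assume "x \<in> A \<times> B"
  then show "tensor_alg \<alpha> \<beta> (return_pmf x) = x"
    using A B by (auto simp: tensor_alg_def convex_algebra_def)
next
  fix \<Phi> assume \<Phi>: "\<Phi> \<in> FD (FD (A \<times> B))"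
  have "map_pmf (map_pmf fst) \<Phi> \<in> FD (FD A)" "map_pmf (map_pmf snd) \<Phi> \<in> FD (FD B)"
    by (auto intro!: FD_map_pmf[OF \<Phi>] elim!: FD_map_pmf)
  then have "\<alpha> (join_pmf (map_pmf (map_pmf fst) \<Phi>)) = \<alpha> (map_pmf \<alpha> (map_pmf (map_pmf fst) \<Phi>))"
    and "\<beta> (join_pmf (map_pmf (map_pmf snd) \<Phi>)) = \<beta> (map_pmf \<beta> (map_pmf (map_pmf snd) \<Phi>))"
    using A B by (simp_all only: convex_algebra_def)
  then show "tensor_alg \<alpha> \<beta> (join_pmf \<Phi>) = tensor_alg \<alpha> \<beta> (map_pmf (tensor_alg \<alpha> \<beta>) \<Phi>)"
    by (simp add: tensor_alg_def map_pmf_join map_pmf_comp)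
qed

section \<open>Closure properties of convex relations\<close>

lemma convex_rel_sub: "convex_rel A \<alpha> B \<beta> R \<Longrightarrow> R \<subseteq> A \<times> B"
  by (simp add: convex_rel_def)

text \<open>The definition speaks of distributions on \<open>R\<close> itself. Indexing the mixed
  pairs by an arbitrary \<open>X\<close> lets one distribution serve several relations with the same
  weights.\<close>

lemma convex_rel_mix:
  assumes "convex_rel A \<alpha> B \<beta> R" "r \<in> FD X" "\<And>x. x \<in> X \<Longrightarrow> (f x, g x) \<in> R"
  shows "(\<alpha> (map_pmf f r), \<beta> (map_pmf g r)) \<in> R"
proof -
  have "map_pmf (\<lambda>x. (f x, g x)) r \<in> FD R"
    using assms(2,3) by (rule FD_map_pmf)
  then have "(\<alpha> (map_pmf fst (map_pmf (\<lambda>x. (f x, g x)) r)),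
              \<beta> (map_pmf snd (map_pmf (\<lambda>x. (f x, g x)) r))) \<in> R"
    using assms(1) unfolding convex_rel_def by blast
  then show ?thesis by (simp add: map_pmf_comp)
qed

lemma convex_rel_converse:
  assumes "convex_rel A \<alpha> B \<beta> R"
  shows "convex_rel B \<beta> A \<alpha> (R\<inverse>)"
  unfolding convex_rel_def
proof (intro conjI ballI)
  show "R\<inverse> \<subseteq> B \<times> A"
    using convex_rel_sub[OF assms] by auto
next
  fix r assume "r \<in> FD (R\<inverse>)"
  then show "(\<beta> (map_pmf fst r), \<alpha> (map_pmf snd r)) \<in> R\<inverse>"
    using convex_rel_mix[OF assms, of r "R\<inverse>" snd fst] by auto
qed

text \<open>Mixing needs a single intermediate point for each mixed pair, hence the choice function.\<close>
lemma convex_rel_comp: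
  assumes R: "convex_rel A \<alpha> B \<beta> R" and S: "convex_rel B \<beta> C \<gamma> S"
  shows "convex_rel A \<alpha> C \<gamma> (R O S)"
  unfolding convex_rel_def
proof (intro conjI ballI)
  show "R O S \<subseteq> A \<times> C"
    using convex_rel_sub[OF R] convex_rel_sub[OF S] by auto
next
  fix r assume r: "r \<in> FD (R O S)"
  obtain m where m: "\<And>x. x \<in> R O S \<Longrightarrow> (fst x, m x) \<in> R \<and> (m x, snd x) \<in> S"
  proof -
    have "\<forall>x\<in>R O S. \<exists>b. (fst x, b) \<in> R \<and> (b, snd x) \<in> S" by auto
    then show ?thesis using that by (auto dest!: bchoice)
  qed
  \<comment> \<open>Both mixtures are taken over the same \<open>r\<close>, so they share the
    intermediate point \<open>\<beta> (map_pmf m r)\<close>.\<close>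
  show "(\<alpha> (map_pmf fst r), \<gamma> (map_pmf snd r)) \<in> R O S"
    using convex_rel_mix[OF R r] convex_rel_mix[OF S r] m by (meson relcompI)
qed

text \<open>The distribution \<open>r\<close> may correlate the two factors, but
  \<open>tensor_alg\<close> depends only on marginals, so each factor is mixed separately over
  \<open>r\<close>.\<close>

lemma convex_rel_rtensor:
  assumes R: "convex_rel A \<alpha> C \<gamma> R" and S: "convex_rel B \<beta> D \<delta> S"
  shows "convex_rel (A \<times> B) (tensor_alg \<alpha> \<beta>) (C \<times> D) (tensor_alg \<gamma> \<delta>) (rtensor R S)"
  unfolding convex_rel_def
proof (intro conjI ballI)
  show "rtensor R S \<subseteq> (A \<times> B) \<times> C \<times> D"
    using convex_rel_sub[OF R] convex_rel_sub[OF S] by (auto simp: rtensor_def)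
next
  fix r assume r: "r \<in> FD (rtensor R S)"
  have "(\<alpha> (map_pmf (\<lambda>x. fst (fst x)) r), \<gamma> (map_pmf (\<lambda>x. fst (snd x)) r)) \<in> R"
    by (rule convex_rel_mix[OF R r]) (auto simp: rtensor_def)
  moreover have "(\<beta> (map_pmf (\<lambda>x. snd (fst x)) r), \<delta> (map_pmf (\<lambda>x. snd (snd x)) r)) \<in> S"
    by (rule convex_rel_mix[OF S r]) (auto simp: rtensor_def)
  ultimately show "(tensor_alg \<alpha> \<beta> (map_pmf fst r), tensor_alg \<gamma> \<delta> (map_pmf snd r)) \<in> rtensor R S"
    by (simp add: rtensor_def tensor_alg_def map_pmf_comp)
qed

text \<open>The second marginal of a distribution on the graph is the image of the first under
  \<open>f\<close>; \<open>hom\<close> then puts the mixed pair back on the graph.\<close>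

lemma convex_rel_graph:
  assumes A: "convex_algebra A \<alpha>" and f: "f ` A \<subseteq> B"
    and hom: "\<And>p. p \<in> FD A \<Longrightarrow> \<beta> (map_pmf f p) = f (\<alpha> p)"
    and R: "R = {(a, f a) | a. a \<in> A}"
  shows "convex_rel A \<alpha> B \<beta> R"
  unfolding convex_rel_def
proof (intro conjI ballI)
  show "R \<subseteq> A \<times> B"
    using f by (auto simp: R)
next
  fix r assume r: "r \<in> FD R"
  have p: "map_pmf fst r \<in> FD A"
    by (rule FD_map_pmf[OF r]) (auto simp: R)
  \<comment> \<open>The two maps are only known to agree on the support of \<open>r\<close>, hence
    the congruence rule.\<close>
  have "map_pmf snd r = map_pmf f (map_pmf fst r)"
    unfolding map_pmf_comp by (rule map_pmf_cong) (auto simp: R dest!: FD_memD[OF r])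
  then show "(\<alpha> (map_pmf fst r), \<beta> (map_pmf snd r)) \<in> R"
    using hom[OF p] convex_algebra_closed[OF A p] by (simp add: R)
qed

section \<open>Convexity of the structure relations\<close>

lemma convex_rel_Id_on: "convex_algebra A \<alpha> \<Longrightarrow> convex_rel A \<alpha> A \<alpha> (Id_on A)"
  by (rule convex_rel_graph[where f = "\<lambda>a. a"]) auto

text \<open>For a rearrangement of coordinates the homomorphism condition is an equality of
  marginals, which composing the projections settles.\<close>

lemma convex_rel_assoc:
  assumes "convex_algebra A \<alpha>" "convex_algebra B \<beta>" "convex_algebra C \<gamma>"
  shows "convex_rel ((A \<times> B) \<times> C) (tensor_alg (tensor_alg \<alpha> \<beta>) \<gamma>)
           (A \<times> (B \<times> C)) (tensor_alg \<alpha> (tensor_alg \<beta> \<gamma>)) (assoc_rel A B C)"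
  using assms
  by (intro convex_rel_graph[where f = "\<lambda>x. (fst (fst x), snd (fst x), snd x)"] convex_algebra_tensor)
     (auto simp: assoc_rel_def tensor_alg_def map_pmf_comp)

lemma convex_rel_lunit:
  "convex_algebra A \<alpha> \<Longrightarrow> convex_rel (Iset \<times> A) (tensor_alg unit_alg \<alpha>) A \<alpha> (lunit_rel A)"
  by (intro convex_rel_graph[where f = snd] convex_algebra_tensor convex_algebra_unit)
     (auto simp: lunit_rel_def tensor_alg_def)

lemma convex_rel_runit:
  "convex_algebra A \<alpha> \<Longrightarrow> convex_rel (A \<times> Iset) (tensor_alg \<alpha> unit_alg) A \<alpha> (runit_rel A)"
  by (intro convex_rel_graph[where f = fst] convex_algebra_tensor convex_algebra_unit)
     (auto simp: runit_rel_def tensor_alg_def)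

lemma convex_rel_swap:
  assumes "convex_algebra A \<alpha>" "convex_algebra B \<beta>"
  shows "convex_rel (A \<times> B) (tensor_alg \<alpha> \<beta>) (B \<times> A) (tensor_alg \<beta> \<alpha>) (swap_rel A B)"
  using assms
  by (intro convex_rel_graph[where f = "\<lambda>x. (snd x, fst x)"] convex_algebra_tensor)
     (auto simp: swap_rel_def tensor_alg_def map_pmf_comp)

lemma convex_rel_copy:
  "convex_algebra A \<alpha> \<Longrightarrow> convex_rel A \<alpha> (A \<times> A) (tensor_alg \<alpha> \<alpha>) (copy_rel A)"
  by (rule convex_rel_graph[where f = "\<lambda>a. (a, a)"])
     (auto simp: copy_rel_def tensor_alg_def map_pmf_comp)

lemma convex_rel_delete:
  "convex_algebra A \<alpha> \<Longrightarrow> convex_rel A \<alpha> Iset unit_alg (delete_rel A)"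
  by (rule convex_rel_graph[where f = "\<lambda>_. ()"]) (auto simp: delete_rel_def)

text \<open>The cup is defined only on the diagonal, so \<open>convex_rel_graph\<close> does not
  apply to it in general; this factorization reduces its convexity to that of copying and
  deleting.\<close>

lemma cup_rel_eq: "cup_rel A = (copy_rel A)\<inverse> O delete_rel A"
  by (auto simp: cup_rel_def copy_rel_def delete_rel_def)

lemma cup_rel_converse: "(cup_rel A)\<inverse> = cap_rel A"
  by (auto simp: cup_rel_def cap_rel_def)

lemma convex_rel_cup:
  "convex_algebra A \<alpha> \<Longrightarrow> convex_rel (A \<times> A) (tensor_alg \<alpha> \<alpha>) Iset unit_alg (cup_rel A)"
  unfolding cup_rel_eq
  by (blast intro: convex_rel_comp convex_rel_converse convex_rel_copy convex_rel_delete)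

lemma convex_rel_cap:
  "convex_algebra A \<alpha> \<Longrightarrow> convex_rel Iset unit_alg (A \<times> A) (tensor_alg \<alpha> \<alpha>) (cap_rel A)"
  using convex_rel_converse[OF convex_rel_cup] by (simp add: cup_rel_converse)

section \<open>Equations between relations\<close>

lemmas structure_rel_defs = rtensor_def assoc_rel_def lunit_rel_def runit_rel_def swap_rel_def
  cap_rel_def cup_rel_def copy_rel_def delete_rel_def

lemma rel_Id_on_comp: "R \<subseteq> A \<times> B \<Longrightarrow> Id_on A O R = R \<and> R O Id_on B = R"
  by auto

text \<open>Structural relations are cut down to the carriers; the inclusions ensure that this cut
  removes no pair from either side. The same holds for the unitors and the symmetry.\<close>

lemma assoc_rel_natural:
  assumes "R \<subseteq> A \<times> D" "S \<subseteq> B \<times> E" "T \<subseteq> C \<times> F"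
  shows "rtensor (rtensor R S) T O assoc_rel D E F = assoc_rel A B C O rtensor R (rtensor S T)"
  using assms by (fastforce simp: rtensor_def assoc_rel_def)

lemma lunit_rel_natural:
  "R \<subseteq> A \<times> B \<Longrightarrow> rtensor (Id_on Iset) R O lunit_rel B = lunit_rel A O R"
  by (fastforce simp: rtensor_def lunit_rel_def)

lemma runit_rel_natural:
  "R \<subseteq> A \<times> B \<Longrightarrow> rtensor R (Id_on Iset) O runit_rel B = runit_rel A O R"
  by (fastforce simp: rtensor_def runit_rel_def)

lemma swap_rel_natural:
  "R \<subseteq> A \<times> C \<Longrightarrow> S \<subseteq> B \<times> D \<Longrightarrow> rtensor R S O swap_rel C D = swap_rel A B O rtensor S R"
  by (fastforce simp: rtensor_def swap_rel_def)

text \<open>An intermediate point on the right is a pair of intermediate points, one for each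
  factor.\<close>

lemma rtensor_comp: "rtensor (R O R') (S O S') = rtensor R S O rtensor R' S'"
  by (fastforce simp: rtensor_def)

lemma rtensor_Id_on: "rtensor (Id_on A) (Id_on B) = Id_on (A \<times> B)"
  by (auto simp: rtensor_def)

lemma rtensor_converse: "(rtensor R S)\<inverse> = rtensor (R\<inverse>) (S\<inverse>)"
  by (auto simp: rtensor_def)

theorem theorem1:
  fixes A :: "'a set" and \<alpha> :: "'a pmf \<Rightarrow> 'a"
    and B :: "'b set" and \<beta> :: "'b pmf \<Rightarrow> 'b"
    and C :: "'c set" and \<gamma> :: "'c pmf \<Rightarrow> 'c"
    and D :: "'d set" and \<delta> :: "'d pmf \<Rightarrow> 'd"
    and E :: "'e set" and \<epsilon> :: "'e pmf \<Rightarrow> 'e"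
    and F :: "'f set" and \<phi> :: "'f pmf \<Rightarrow> 'f"
  assumes "convex_algebra A \<alpha>" and "convex_algebra B \<beta>" and "convex_algebra C \<gamma>"
    and "convex_algebra D \<delta>" and "convex_algebra E \<epsilon>" and "convex_algebra F \<phi>"
  shows
  \<comment> \<open>category ConvexRel\<close>
    "convex_rel A \<alpha> A \<alpha> (Id_on A)
   \<and> (\<forall>R S. convex_rel A \<alpha> B \<beta> R \<and> convex_rel B \<beta> C \<gamma> S \<longrightarrow> convex_rel A \<alpha> C \<gamma> (R O S))
   \<and> (\<forall>R. convex_rel A \<alpha> B \<beta> R \<longrightarrow> Id_on A O R = R \<and> R O Id_on B = R)
   \<and> (\<forall>R S T. convex_rel A \<alpha> B \<beta> R \<and> convex_rel B \<beta> C \<gamma> S \<and> convex_rel C \<gamma> D \<delta> T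
        \<longrightarrow> (R O S) O T = R O (S O T))
  \<comment> \<open>monoidal product and unit objects\<close>
   \<and> convex_algebra (A \<times> B) (tensor_alg \<alpha> \<beta>)
   \<and> convex_algebra Iset unit_alg
  \<comment> \<open>monoidal product on morphisms is a bifunctor\<close>
   \<and> (\<forall>R S. convex_rel A \<alpha> C \<gamma> R \<and> convex_rel B \<beta> D \<delta> S
        \<longrightarrow> convex_rel (A \<times> B) (tensor_alg \<alpha> \<beta>) (C \<times> D) (tensor_alg \<gamma> \<delta>) (rtensor R S))
   \<and> rtensor (Id_on A) (Id_on B) = Id_on (A \<times> B)
   \<and> (\<forall>R R' S S'. convex_rel A \<alpha> B \<beta> R \<and> convex_rel B \<beta> C \<gamma> R'
          \<and> convex_rel D \<delta> E \<epsilon> S \<and> convex_rel E \<epsilon> F \<phi> S'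
        \<longrightarrow> rtensor (R O R') (S O S') = rtensor R S O rtensor R' S')
  \<comment> \<open>associator: convex, invertible, natural\<close>
   \<and> convex_rel ((A \<times> B) \<times> C) (tensor_alg (tensor_alg \<alpha> \<beta>) \<gamma>)
                (A \<times> (B \<times> C)) (tensor_alg \<alpha> (tensor_alg \<beta> \<gamma>)) (assoc_rel A B C)
   \<and> assoc_rel A B C O (assoc_rel A B C)\<inverse> = Id_on ((A \<times> B) \<times> C)
   \<and> (assoc_rel A B C)\<inverse> O assoc_rel A B C = Id_on (A \<times> (B \<times> C))
   \<and> (\<forall>R S T. convex_rel A \<alpha> D \<delta> R \<and> convex_rel B \<beta> E \<epsilon> S \<and> convex_rel C \<gamma> F \<phi> T
        \<longrightarrow> rtensor (rtensor R S) T O assoc_rel D E F = assoc_rel A B C O rtensor R (rtensor S T))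
  \<comment> \<open>left unitor\<close>
   \<and> convex_rel (Iset \<times> A) (tensor_alg unit_alg \<alpha>) A \<alpha> (lunit_rel A)
   \<and> lunit_rel A O (lunit_rel A)\<inverse> = Id_on (Iset \<times> A)
   \<and> (lunit_rel A)\<inverse> O lunit_rel A = Id_on A
   \<and> (\<forall>R. convex_rel A \<alpha> B \<beta> R \<longrightarrow> rtensor (Id_on Iset) R O lunit_rel B = lunit_rel A O R)
  \<comment> \<open>right unitor\<close>
   \<and> convex_rel (A \<times> Iset) (tensor_alg \<alpha> unit_alg) A \<alpha> (runit_rel A)
   \<and> runit_rel A O (runit_rel A)\<inverse> = Id_on (A \<times> Iset)
   \<and> (runit_rel A)\<inverse> O runit_rel A = Id_on A
   \<and> (\<forall>R. convex_rel A \<alpha> B \<beta> R \<longrightarrow> rtensor R (Id_on Iset) O runit_rel B = runit_rel A O R)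
  \<comment> \<open>symmetry\<close>
   \<and> convex_rel (A \<times> B) (tensor_alg \<alpha> \<beta>) (B \<times> A) (tensor_alg \<beta> \<alpha>) (swap_rel A B)
   \<and> swap_rel A B O swap_rel B A = Id_on (A \<times> B)
   \<and> (\<forall>R S. convex_rel A \<alpha> C \<gamma> R \<and> convex_rel B \<beta> D \<delta> S
        \<longrightarrow> rtensor R S O swap_rel C D = swap_rel A B O rtensor S R)
  \<comment> \<open>pentagon, triangle, hexagon\<close>
   \<and> assoc_rel (A \<times> B) C D O assoc_rel A B (C \<times> D)
       = rtensor (assoc_rel A B C) (Id_on D) O assoc_rel A (B \<times> C) D O rtensor (Id_on A) (assoc_rel B C D)
   \<and> assoc_rel A Iset B O rtensor (Id_on A) (lunit_rel B) = rtensor (runit_rel A) (Id_on B)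
   \<and> assoc_rel A B C O swap_rel A (B \<times> C) O assoc_rel B C A
       = rtensor (swap_rel A B) (Id_on C) O assoc_rel B A C O rtensor (Id_on B) (swap_rel A C)
  \<comment> \<open>dagger = relational converse: involutive contravariant identity-on-objects functor\<close>
   \<and> (\<forall>R. convex_rel A \<alpha> B \<beta> R \<longrightarrow> convex_rel B \<beta> A \<alpha> (R\<inverse>) \<and> (R\<inverse>)\<inverse> = R)
   \<and> (Id_on A)\<inverse> = Id_on A
   \<and> (\<forall>R S. convex_rel A \<alpha> B \<beta> R \<and> convex_rel B \<beta> C \<gamma> S \<longrightarrow> (R O S)\<inverse> = S\<inverse> O R\<inverse>)
  \<comment> \<open>dagger symmetric monoidal: dagger commutes with tensor, structural isos unitary\<close>
   \<and> (\<forall>R S. convex_rel A \<alpha> C \<gamma> R \<and> convex_rel B \<beta> D \<delta> S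
        \<longrightarrow> (rtensor R S)\<inverse> = rtensor (R\<inverse>) (S\<inverse>))
   \<and> (swap_rel A B)\<inverse> = swap_rel B A
  \<comment> \<open>dagger compact structure: cap and cup\<close>
   \<and> convex_rel Iset unit_alg (A \<times> A) (tensor_alg \<alpha> \<alpha>) (cap_rel A)
   \<and> convex_rel (A \<times> A) (tensor_alg \<alpha> \<alpha>) Iset unit_alg (cup_rel A)
   \<and> cup_rel A = (cap_rel A)\<inverse>
   \<and> cup_rel A = swap_rel A A O (cap_rel A)\<inverse>
   \<and> (lunit_rel A)\<inverse> O rtensor (cap_rel A) (Id_on A) O assoc_rel A A A
       O rtensor (Id_on A) (cup_rel A) O runit_rel A = Id_on A
   \<and> (runit_rel A)\<inverse> O rtensor (Id_on A) (cap_rel A) O (assoc_rel A A A)\<inverse>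
       O rtensor (cup_rel A) (Id_on A) O lunit_rel A = Id_on A
  \<comment> \<open>commutative special dagger Frobenius structure (copy, delete, and their daggers)\<close>
   \<and> convex_rel A \<alpha> (A \<times> A) (tensor_alg \<alpha> \<alpha>) (copy_rel A)
   \<and> convex_rel A \<alpha> Iset unit_alg (delete_rel A)
   \<and> convex_rel (A \<times> A) (tensor_alg \<alpha> \<alpha>) A \<alpha> ((copy_rel A)\<inverse>)
   \<and> convex_rel Iset unit_alg A \<alpha> ((delete_rel A)\<inverse>)
   \<and> copy_rel A O rtensor (copy_rel A) (Id_on A) O assoc_rel A A A
       = copy_rel A O rtensor (Id_on A) (copy_rel A)
   \<and> copy_rel A O rtensor (delete_rel A) (Id_on A) O lunit_rel A = Id_on A
   \<and> copy_rel A O rtensor (Id_on A) (delete_rel A) O runit_rel A = Id_on A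
   \<and> copy_rel A O swap_rel A A = copy_rel A
   \<and> rtensor ((copy_rel A)\<inverse>) (Id_on A) O (copy_rel A)\<inverse>
       = assoc_rel A A A O rtensor (Id_on A) ((copy_rel A)\<inverse>) O (copy_rel A)\<inverse>
   \<and> (lunit_rel A)\<inverse> O rtensor ((delete_rel A)\<inverse>) (Id_on A) O (copy_rel A)\<inverse> = Id_on A
   \<and> (runit_rel A)\<inverse> O rtensor (Id_on A) ((delete_rel A)\<inverse>) O (copy_rel A)\<inverse> = Id_on A
   \<and> swap_rel A A O (copy_rel A)\<inverse> = (copy_rel A)\<inverse>
   \<and> rtensor (copy_rel A) (Id_on A) O assoc_rel A A A O rtensor (Id_on A) ((copy_rel A)\<inverse>)
       = (copy_rel A)\<inverse> O copy_rel A
   \<and> rtensor (Id_on A) (copy_rel A) O (assoc_rel A A A)\<inverse> O rtensor ((copy_rel A)\<inverse>) (Id_on A)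
       = (copy_rel A)\<inverse> O copy_rel A
   \<and> copy_rel A O (copy_rel A)\<inverse> = Id_on A"
  \<comment> \<open>Convexity claims follow from the closure lemmas. Unit laws and naturality use
    the inclusions from \<open>convex_rel_sub\<close>; associativity and the dagger of a composite
    are plain relation algebra. Inverses, coherence, snake and Frobenius equations are checked on
    points.\<close>
  by (intro conjI allI impI;
      (elim conjE)?;
      ((rule assms convex_rel_Id_on convex_rel_comp convex_algebra_tensor convex_algebra_unit
          convex_rel_rtensor convex_rel_assoc convex_rel_lunit convex_rel_runit convex_rel_swap
          convex_rel_converse convex_rel_cap convex_rel_cup convex_rel_copy convex_rel_delete
        | assumption)+; fail)?;
      ((intro rtensor_comp rtensor_Id_on rtensor_converse rel_Id_on_comp[THEN conjunct1]
         rel_Id_on_comp[THEN conjunct2] assoc_rel_natural lunit_rel_natural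
         runit_rel_natural swap_rel_natural; erule convex_rel_sub); fail)?;
      ((simp only: O_assoc converse_converse converse_Id_on converse_relcomp); fail)?;
      (force simp: structure_rel_defs; fail)?)

end
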